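(* Let $K\subset\mathbb{R}^2$ be a polygon with $N$ edges, and let $\{\pi_n\}_{n\in\mathbb{N}_0}$ be a sequence of orthogonal polynomials on $[a,b]$ with respect to a weight function $\omega$. For a fixed $m\in\mathbb{N}$, the following statements hold, where $\mathcal{A}_{m,N}=(\partial K,\mathcal{S}_m^0(\partial K),\Sigma_{\partial K})$ is built with the interval $[a,b]$ and the weight $\omega$: (1) If $mN$ is odd, then the triple $\mathcal{A}_{m,N}$ defines a finite element. (2) If $mN$ is even, then the following are equivalent: (a) the triple $\mathcal{A}_{m,N}$ defines a finite element; (b) $|\pi_m(b)|\neq|\pi_m(a)|$; (c) the polynomial $\pi_m\pi_m'$ is not orthogonal to the constant functions on $[a,b]$ with respect to the constant weight function $1$, i.e. $\int_a^b\pi_m(x)\pi_m'(x)\,dx\neq0$.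
   Context: $\mathbb{N}=\{1,2,\dots\}$, $\mathbb{N}_0=\mathbb{N}\cup\{0\}$, $a<b$ are real numbers. A weight function $\omega$ on $[a,b]$ is a nonnegative integrable function with $\int_a^b\omega(x)\,dx>0$ and all moments $\int_a^b x^n\omega(x)\,dx$ finite. A sequence of real polynomials $\{\pi_n\}_{n\in\mathbb{N}_0}$ is orthogonal on $[a,b]$ with respect to $\omega$ if $\deg\pi_n=n$ and $\int_a^b\pi_m\pi_n\omega\,dx=K_n\delta_{mn}$ with $K_n\ne0$ for all $m,n$. $K$ has vertices $\mathbf v_1,\dots,\mathbf v_N$ ordered counter-clockwise, edges $e_i=[\mathbf v_i,\mathbf v_{i+1}]$, $i=1,\dots,N$, with $\mathbf v_{N+1}=\mathbf v_1$. Each edge is parametrized by $\psi_i(x)=\frac{b-x}{b-a}\mathbf v_i+\frac{x-a}{b-a}\mathbf v_{i+1}$, $x\in[a,b]$, and for a function $u$ on $\partial K$ with continuous restriction to each edge, $\widetilde\gamma_i(u)(x)=u|_{e_i}(\psi_i(x))$. $\mathcal{S}_m(\partial K)$ is the space of $f\in L^2(\partial K)$ such that $f|_{e_i}$ is a polynomial of degree at most $m$ on $e_i$ for each $i$ (no continuity at vertices required), and $\mathcal{S}_m^0(\partial K)=\mathcal{S}_m(\partial K)\cap C^0(\partial K)$; $\dim\mathcal{S}_m^0(\partial K)=mN$. Given a basis $\{b_j: j=1,\dots,mN\}$ of $\mathcal{S}_{m-1}(\partial K)$, $\Sigma_{\partial K}=\{\mathcal L_j: j=1,\dots,mN\}$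 with $\mathcal L_j(f)=\sum_{i=1}^N\int_a^b\widetilde\gamma_i(f)(x)\,\widetilde\gamma_i(b_j)(x)\,\omega(x)\,dx$ for $f\in\mathcal{S}_m^0(\partial K)$. The triple $\mathcal{A}_{m,N}$ "defines a finite element" means unisolvence: the only $p\in\mathcal{S}_m^0(\partial K)$ with $\mathcal L_j(p)=0$ for all $j=1,\dots,mN$ is $p=0$. *)

theory Defs
  imports "HOL-Analysis.Analysis" "HOL-Computational_Algebra.Polynomial"
begin

definition weight_function :: "real \<Rightarrow> real \<Rightarrow> (real \<Rightarrow> real) \<Rightarrow> bool" where
  "weight_function a b \<omega> \<longleftrightarrow>
     (\<forall>x\<in>{a..b}. 0 \<le> \<omega> x) \<and>
     set_integrable lebesgue {a..b} \<omega> \<and>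
     0 < (LINT x:{a..b}|lebesgue. \<omega> x) \<and>
     (\<forall>n. set_integrable lebesgue {a..b} (\<lambda>x. x ^ n * \<omega> x))"

definition orthogonal_polynomials ::
    "real \<Rightarrow> real \<Rightarrow> (real \<Rightarrow> real) \<Rightarrow> (nat \<Rightarrow> real poly) \<Rightarrow> bool" where
  "orthogonal_polynomials a b \<omega> \<pi> \<longleftrightarrow>
     (\<forall>n. degree (\<pi> n) = n) \<and>
     (\<exists>\<kappa> :: nat \<Rightarrow> real. (\<forall>n. \<kappa> n \<noteq> 0) \<and>
        (\<forall>m n. (LINT x:{a..b}|lebesgue. poly (\<pi> m) x * poly (\<pi> n) x * \<omega> x) =
               (if m = n then \<kappa> n else 0)))"

text \<open>Vertices are indexed by \<open>1, \<dots>, N\<close>; the index \<open>N + 1\<close> stands for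
  the first vertex again.\<close>

definition edge :: "(nat \<Rightarrow> real^2) \<Rightarrow> nat \<Rightarrow> (real^2) set" where
  "edge v i = closed_segment (v i) (v (i + 1))"

text \<open>A polygon is a compact set with nonempty interior whose boundary is a simple closed
  polygonal line: two different edges have only common end points in common. By the Jordan curve
  theorem \<open>K\<close> is then the union of that line and its inside. The last condition
  (positive signed area, by the shoelace formula) expresses that the vertices are listed
  counter-clockwise. Interior angles equal to \<open>180\<close> degrees are permitted.\<close>

definition polygon :: "(real^2) set \<Rightarrow> nat \<Rightarrow> (nat \<Rightarrow> real^2) \<Rightarrow> bool" where
  "polygon K N v \<longleftrightarrow>
     3 \<le> N \<and> v (N + 1) = v 1 \<and> inj_on v {1..N} \<and>
     (\<forall>i\<in>{1..N}. \<forall>j\<in>{1..N}. i \<noteq> j \<longrightarrow>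
        edge v i \<inter> edge v j = {v i, v (i + 1)} \<inter> {v j, v (j + 1)}) \<and>
     compact K \<and> interior K \<noteq> {} \<and> frontier K = (\<Union>i\<in>{1..N}. edge v i) \<and>
     0 < (\<Sum>i = 1..N. v i $ 1 * v (i + 1) $ 2 - v (i + 1) $ 1 * v i $ 2)"

definition edge_param :: "real \<Rightarrow> real \<Rightarrow> (nat \<Rightarrow> real^2) \<Rightarrow> nat \<Rightarrow> real \<Rightarrow> real^2" where
  "edge_param a b v i x =
     ((b - x) / (b - a)) *\<^sub>R v i + ((x - a) / (b - a)) *\<^sub>R v (i + 1)"

definition edge_trace ::
    "real \<Rightarrow> real \<Rightarrow> (nat \<Rightarrow> real^2) \<Rightarrow> nat \<Rightarrow> (real^2 \<Rightarrow> real) \<Rightarrow> real \<Rightarrow> real" where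
  "edge_trace a b v i u x = u (edge_param a b v i x)"

text \<open>Elements of \<open>L\<^sup>2\<close> of the boundary are represented by functions on the plane, two of
  which represent the same element iff they agree almost everywhere (with respect to arc length)
  on every edge. In particular the values at the vertices are immaterial.\<close>

definition boundary_ae_eq ::
    "nat \<Rightarrow> (nat \<Rightarrow> real^2) \<Rightarrow> (real^2 \<Rightarrow> real) \<Rightarrow> (real^2 \<Rightarrow> real) \<Rightarrow> bool" where
  "boundary_ae_eq N v f g \<longleftrightarrow>
     (\<forall>i\<in>{1..N}. AE t in lebesgue_on {0..1}.
        f (edge_param 0 1 v i t) = g (edge_param 0 1 v i t))"

text \<open>Being a polynomial of degree at most \<open>m\<close> on an edge means being one in an affine
  parameter of the edge; this does not depend on the affine parametrization chosen. Such functions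
  are automatically square integrable over the boundary.\<close>

definition piecewise_poly_space ::
    "nat \<Rightarrow> (nat \<Rightarrow> real^2) \<Rightarrow> nat \<Rightarrow> (real^2 \<Rightarrow> real) set" where
  "piecewise_poly_space N v m =
     {f. \<forall>i\<in>{1..N}. \<exists>p :: real poly. degree p \<le> m \<and>
           (AE t in lebesgue_on {0..1}. f (edge_param 0 1 v i t) = poly p t)}"

definition continuous_piecewise_poly_space ::
    "(real^2) set \<Rightarrow> nat \<Rightarrow> (nat \<Rightarrow> real^2) \<Rightarrow> nat \<Rightarrow> (real^2 \<Rightarrow> real) set" where
  "continuous_piecewise_poly_space K N v m =
     {f \<in> piecewise_poly_space N v m. continuous_on (frontier K) f}"

text \<open>A basis of the space of piecewise polynomials, as a subspace of \<open>L\<^sup>2\<close>: linear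
  combinations are compared up to almost everywhere equality.\<close>

definition piecewise_poly_basis ::
    "nat \<Rightarrow> (nat \<Rightarrow> real^2) \<Rightarrow> nat \<Rightarrow> nat set \<Rightarrow> (nat \<Rightarrow> real^2 \<Rightarrow> real) \<Rightarrow> bool" where
  "piecewise_poly_basis N v m J \<beta> \<longleftrightarrow>
     (\<forall>j\<in>J. \<beta> j \<in> piecewise_poly_space N v m) \<and>
     (\<forall>f\<in>piecewise_poly_space N v m. \<exists>c :: nat \<Rightarrow> real.
        boundary_ae_eq N v f (\<lambda>z. \<Sum>j\<in>J. c j * \<beta> j z)) \<and>
     (\<forall>c :: nat \<Rightarrow> real.
        boundary_ae_eq N v (\<lambda>z. \<Sum>j\<in>J. c j * \<beta> j z) (\<lambda>z. 0) \<longrightarrow> (\<forall>j\<in>J. c j = 0))"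

definition boundary_moment ::
    "real \<Rightarrow> real \<Rightarrow> (real \<Rightarrow> real) \<Rightarrow> nat \<Rightarrow> (nat \<Rightarrow> real^2) \<Rightarrow>
     (real^2 \<Rightarrow> real) \<Rightarrow> (real^2 \<Rightarrow> real) \<Rightarrow> real" where
  "boundary_moment a b \<omega> N v g f =
     (\<Sum>i = 1..N. LINT x:{a..b}|lebesgue. edge_trace a b v i f x * edge_trace a b v i g x * \<omega> x)"

text \<open>The condition is unisolvence. Functions in \<open>P\<close> are regarded as functions on the
  domain \<open>D\<close>, so the zero element is any function vanishing on \<open>D\<close>.\<close>

fun defines_finite_element ::
    "'a set \<times> ('a \<Rightarrow> real) set \<times> (('a \<Rightarrow> real) \<Rightarrow> real) set \<Rightarrow> bool" where
  "defines_finite_element (D, P, L) \<longleftrightarrow>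
     (\<forall>p\<in>P. (\<forall>l\<in>L. l p = 0) \<longrightarrow> (\<forall>z\<in>D. p z = 0))"

definition element_triple ::
    "real \<Rightarrow> real \<Rightarrow> (real \<Rightarrow> real) \<Rightarrow> (real^2) set \<Rightarrow> nat \<Rightarrow> (nat \<Rightarrow> real^2) \<Rightarrow> nat \<Rightarrow>
     (nat \<Rightarrow> real^2 \<Rightarrow> real) \<Rightarrow>
     (real^2) set \<times> (real^2 \<Rightarrow> real) set \<times> ((real^2 \<Rightarrow> real) \<Rightarrow> real) set" where
  "element_triple a b \<omega> K N v m \<beta> =
     (frontier K,
      continuous_piecewise_poly_space K N v m,
      (\<lambda>j. boundary_moment a b \<omega> N v (\<beta> j)) ` {1..m * N})"

end

theory Submission imports Defs begin

text \<open>Let \<open>f\<close> be a continuous piecewise polynomial of degree at most \<open>m\<close> all of whose moments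
  vanish. A polynomial of degree less than \<open>m\<close> on a single edge, continued by zero, is a combination
  of the basis functions, so the trace of \<open>f\<close> on each edge is orthogonal to all polynomials of
  degree less than \<open>m\<close> and hence equals \<open>c\<^sub>i \<pi>\<^sub>m\<close> on the \<open>i\<close>-th edge. By positivity of the weight,
  \<open>\<pi>\<^sub>m\<close> does not vanish at \<open>a\<close> or \<open>b\<close>. Continuity at the vertices therefore says
  \<open>c\<^sub>i\<^sub>+\<^sub>1 = r c\<^sub>i\<close> cyclically, where \<open>r = \<pi>\<^sub>m(b) / \<pi>\<^sub>m(a)\<close>. If \<open>r\<^sup>N \<noteq> 1\<close>, this forces \<open>f = 0\<close>
  (\<open>finite_element_if_power_ne_1\<close>); if \<open>r\<^sup>N = 1\<close>, the multiples \<open>r\<^sup>i \<pi>\<^sub>m\<close> on the edges glue to a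
  nonzero continuous function with vanishing moments (\<open>not_finite_element_if_power_eq_1\<close>).

  It remains to decide when \<open>r\<^sup>N = 1\<close>. All zeros of \<open>\<pi>\<^sub>m\<close> lie in \<open>(a, b)\<close> by the classical
  argument, of which only the consequence that \<open>r\<close> has the sign \<open>(-1)\<^sup>m\<close> is needed
  (\<open>orthogonal_polynomial_endpoint_sign\<close>). Thus \<open>r\<^sup>N = 1\<close> iff \<open>m N\<close> is even and \<open>\<bar>r\<bar> = 1\<close>. Finally
  the integral of \<open>\<pi>\<^sub>m \<pi>\<^sub>m'\<close> is half of \<open>\<pi>\<^sub>m(b)\<^sup>2 - \<pi>\<^sub>m(a)\<^sup>2\<close>.

  Almost everywhere equality of traces is handled through negligible exceptional sets, which affect
  neither integrability nor the value of an integral.\<close>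

section \<open>Integrals of polynomials against a weight\<close>

text \<open>The linear functional on polynomials given by integration against \<open>\<omega>\<close>.\<close>

definition weighted_integral :: "real \<Rightarrow> real \<Rightarrow> (real \<Rightarrow> real) \<Rightarrow> real poly \<Rightarrow> real" where
  "weighted_integral a b \<omega> p = (LINT x:{a..b}|lebesgue. poly p x * \<omega> x)"

lemma set_integrable_poly_weight:
  assumes "weight_function a b \<omega>"
  shows "set_integrable lebesgue {a..b} (\<lambda>x. poly p x * \<omega> x)"
proof -
  have "set_integrable lebesgue {a..b} (\<lambda>x. coeff p i * (x ^ i * \<omega> x))" for i
    using assms by (intro set_integrable_mult_right) (auto simp: weight_function_def)
  then have "set_integrable lebesgue {a..b} (\<lambda>x. \<Sum>i\<le>degree p. coeff p i * (x ^ i * \<omega> x))"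
    unfolding set_integrable_def scaleR_sum_right by (rule Bochner_Integration.integrable_sum)
  then show ?thesis
    by (simp add: poly_altdef sum_distrib_right mult.assoc)
qed

lemma weighted_integral_add:
  assumes "weight_function a b \<omega>"
  shows "weighted_integral a b \<omega> (p + q) = weighted_integral a b \<omega> p + weighted_integral a b \<omega> q"
  using set_integral_add(2)[OF set_integrable_poly_weight[OF assms] set_integrable_poly_weight[OF assms]]
  by (simp add: weighted_integral_def distrib_right)

lemma weighted_integral_smult:
  "weighted_integral a b \<omega> (smult c p) = c * weighted_integral a b \<omega> p"
  by (simp add: weighted_integral_def mult.assoc)

lemma weighted_integral_0: "weighted_integral a b \<omega> 0 = 0"
  by (simp add: weighted_integral_def)

lemma weighted_integral_diff:
  assumes "weight_function a b \<omega>"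
  shows "weighted_integral a b \<omega> (p - q) = weighted_integral a b \<omega> p - weighted_integral a b \<omega> q"
  using weighted_integral_add[OF assms, of "p - q" q] by simp

lemma weighted_integral_sum:
  assumes "weight_function a b \<omega>"
  shows "weighted_integral a b \<omega> (\<Sum>j\<in>J. p j) = (\<Sum>j\<in>J. weighted_integral a b \<omega> (p j))"
  by (induction J rule: infinite_finite_induct)
    (auto simp: weighted_integral_0 weighted_integral_add[OF assms])

text \<open>Definiteness: the product vanishes almost everywhere and a nonzero polynomial has only
  finitely many zeros, so the weight itself would have integral zero.\<close>

lemma weighted_integral_nonneg_eq_0:
  assumes w: "weight_function a b \<omega>" and "\<And>x. x \<in> {a..b} \<Longrightarrow> 0 \<le> poly p x"
    and "weighted_integral a b \<omega> p = 0"
  shows "p = 0"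
proof (rule ccontr)
  assume "p \<noteq> 0"
  have "AE x in lebesgue. indicator {a..b} x *\<^sub>R (poly p x * \<omega> x) = 0"
  proof (subst integral_nonneg_eq_0_iff_AE[symmetric])
    show "integrable lebesgue (\<lambda>x. indicator {a..b} x *\<^sub>R (poly p x * \<omega> x))"
      using set_integrable_poly_weight[OF w] by (simp add: set_integrable_def)
    show "AE x in lebesgue. 0 \<le> indicator {a..b} x *\<^sub>R (poly p x * \<omega> x)"
      using assms(2) w by (intro AE_I2) (auto simp: weight_function_def indicator_def)
    show "(LINT x|lebesgue. indicator {a..b} x *\<^sub>R (poly p x * \<omega> x)) = 0"
      using assms(3) by (simp add: weighted_integral_def set_lebesgue_integral_def)
  qed
  then obtain S where S: "negligible S" "{x. indicator {a..b} x *\<^sub>R (poly p x * \<omega> x) \<noteq> 0} \<subseteq> S"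
    unfolding eventually_ae_filter_negligible by blast
  have neg: "negligible (S \<union> {x. poly p x = 0})"
    by (rule negligible_Un[OF S(1) negligible_finite[OF poly_roots_finite[OF \<open>p \<noteq> 0\<close>]]])
  have "(LINT x:{a..b}|lebesgue. \<omega> x) = integral {a..b} \<omega>"
    using w by (intro set_lebesgue_integral_eq_integral(2)) (simp add: weight_function_def)
  also have "\<dots> = integral {a..b} (\<lambda>x. 0)"
    using S(2) by (intro integral_spike[OF neg]) (auto simp: indicator_def)
  finally show False
    using w by (simp add: weight_function_def)
qed

section \<open>Orthogonal polynomials and their values at the end points\<close>

lemma orthogonal_polynomials_degree: "orthogonal_polynomials a b \<omega> \<pi> \<Longrightarrow> degree (\<pi> n) = n"
  by (simp add: orthogonal_polynomials_def)

lemma orthogonal_polynomials_nonzero: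
  assumes "orthogonal_polynomials a b \<omega> \<pi>"
  shows "\<pi> n \<noteq> 0"
proof
  assume "\<pi> n = 0"
  moreover obtain \<kappa> :: "nat \<Rightarrow> real" where "\<kappa> n \<noteq> 0"
    "(LINT x:{a..b}|lebesgue. poly (\<pi> n) x * poly (\<pi> n) x * \<omega> x) = \<kappa> n"
    using assms unfolding orthogonal_polynomials_def by metis
  ultimately show False by simp
qed

lemma orthogonal_to_lower_degree:
  assumes w: "weight_function a b \<omega>" and o: "orthogonal_polynomials a b \<omega> \<pi>" and "degree q < m"
  shows "weighted_integral a b \<omega> (\<pi> m * q) = 0"
  using assms(3)
proof (induction "degree q" arbitrary: q rule: less_induct)
  case less
  define d where "d = degree q"
  define c where "c = lead_coeff q / lead_coeff (\<pi> d)"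
  define s where "s = q - smult c (\<pi> d)"
  have pd: "degree (\<pi> d) = d" "\<pi> d \<noteq> 0"
    using o by (auto simp: orthogonal_polynomials_degree orthogonal_polynomials_nonzero)
  have 1: "weighted_integral a b \<omega> (\<pi> m * \<pi> d) = 0"
    using o less.prems unfolding orthogonal_polynomials_def weighted_integral_def d_def by auto
  have "degree s \<le> d"
    unfolding s_def using pd by (intro degree_diff_le) (auto simp: d_def)
  moreover have "coeff s d = 0"
    using pd by (simp add: s_def c_def flip: d_def) (metis leading_coeff_0_iff)
  ultimately have "s = 0 \<or> degree s < degree q"
    unfolding d_def[symmetric] using eq_zero_or_degree_less by blast
  then have 2: "weighted_integral a b \<omega> (\<pi> m * s) = 0"
    using less by (auto simp: weighted_integral_0)
  have "\<pi> m * q = \<pi> m * s + smult c (\<pi> m * \<pi> d)"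
    by (simp add: s_def algebra_simps)
  then show ?case
    by (simp add: 1 2 weighted_integral_add[OF w] weighted_integral_smult)
qed

lemma orthogonal_to_lower_degree_imp_multiple:
  assumes w: "weight_function a b \<omega>" and o: "orthogonal_polynomials a b \<omega> \<pi>"
    and "1 \<le> m" "degree p \<le> m"
    and orth: "\<And>q. degree q \<le> m - 1 \<Longrightarrow> weighted_integral a b \<omega> (p * q) = 0"
  shows "\<exists>c. p = smult c (\<pi> m)"
proof -
  define c where "c = coeff p m / coeff (\<pi> m) m"
  define s where "s = p - smult c (\<pi> m)"
  have pm: "degree (\<pi> m) = m" "\<pi> m \<noteq> 0"
    using o by (auto simp: orthogonal_polynomials_degree orthogonal_polynomials_nonzero)
  then have "coeff (\<pi> m) m \<noteq> 0"
    by (metis leading_coeff_0_iff)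
  then have "coeff s m = 0"
    by (simp add: s_def c_def)
  moreover have "degree s \<le> m"
    unfolding s_def using pm assms by (intro degree_diff_le) auto
  ultimately have s: "s = 0 \<or> degree s < m"
    using eq_zero_or_degree_less by blast
  then have ds: "degree s < m"
    using \<open>1 \<le> m\<close> by auto
  have "s * s = (p - smult c (\<pi> m)) * s"
    by (simp add: s_def)
  also have "\<dots> = p * s - smult c (\<pi> m * s)"
    by (simp add: left_diff_distrib)
  finally have "s * s = p * s - smult c (\<pi> m * s)" .
  moreover have "weighted_integral a b \<omega> (p * s) = 0"
    using ds by (intro orth) auto
  ultimately have "weighted_integral a b \<omega> (s * s) = 0"
    by (simp add: weighted_integral_diff[OF w] weighted_integral_smult
        orthogonal_to_lower_degree[OF w o ds])
  then have "s * s = 0"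
    by (rule weighted_integral_nonneg_eq_0[OF w, rotated]) simp
  then show ?thesis
    by (auto simp: s_def)
qed

text \<open>If \<open>\<pi>\<^sub>m = (x - e) q\<close> for an end point \<open>e\<close>, then \<open>\<pi>\<^sub>m q = (x - e) q\<^sup>2\<close> has constant sign on
  the interval, while its weighted integral is zero.\<close>

lemma orthogonal_polynomial_endpoint_nonzero:
  assumes w: "weight_function a b \<omega>" and o: "orthogonal_polynomials a b \<omega> \<pi>"
    and "1 \<le> m" "e = a \<or> e = b"
  shows "poly (\<pi> m) e \<noteq> 0"
proof
  assume "poly (\<pi> m) e = 0"
  then obtain q where q: "\<pi> m = [:- e, 1:] * q"
    by (metis dvdE poly_eq_0_iff_dvd)
  have pm: "degree (\<pi> m) = m" "\<pi> m \<noteq> 0"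
    using o by (auto simp: orthogonal_polynomials_degree orthogonal_polynomials_nonzero)
  have "q \<noteq> 0"
    using pm q by auto
  then have "degree (\<pi> m) = 1 + degree q"
    unfolding q by (subst degree_mult_eq) auto
  then have "weighted_integral a b \<omega> (\<pi> m * q) = 0"
    using pm by (intro orthogonal_to_lower_degree[OF w o]) auto
  then have int: "weighted_integral a b \<omega> (smult c (\<pi> m * q)) = 0" for c
    by (simp add: weighted_integral_smult)
  have val: "poly (smult c (\<pi> m * q)) x = c * (x - e) * (poly q x)\<^sup>2" for c x
    by (simp add: q power2_eq_square algebra_simps)
  have "smult (if e = a then 1 else - 1) (\<pi> m * q) = 0"
    by (rule weighted_integral_nonneg_eq_0[OF w _ int], unfold val)
      (use assms(4) in \<open>auto intro!: mult_nonneg_nonneg simp: mult_nonpos_nonneg\<close>)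
  then show False
    using pm \<open>q \<noteq> 0\<close> by (auto split: if_splits)
qed

text \<open>Multiplying a polynomial by one linear factor for each of its zeros in \<open>(a, b)\<close>, counted
  with multiplicity, doubles the multiplicity of each of them and so removes all sign changes. Every
  linear factor has opposite signs at \<open>a\<close> and \<open>b\<close>, which determines the sign of \<open>q(a) q(b)\<close>.\<close>

lemma exists_sign_matching_poly:
  fixes p :: "real poly"
  assumes "a < b" "poly p a \<noteq> 0" "poly p b \<noteq> 0"
  shows "\<exists>q. q \<noteq> 0 \<and> degree q \<le> degree p \<and> (\<forall>x\<in>{a..b}. 0 \<le> poly (p * q) x) \<and>
           0 < (- 1) ^ degree q * (poly q a * poly q b)"
  using assms(2,3)
proof (induction "degree p" arbitrary: p rule: less_induct)
  case less
  show ?case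
  proof (cases "\<exists>c\<in>{a<..<b}. poly p c = 0")
    case True
    then obtain c p' where c: "a < c" "c < b" and p': "p = [:- c, 1:] * p'"
      by (auto simp: poly_eq_0_iff_dvd dvd_def)
    have "p' \<noteq> 0" "poly p' a \<noteq> 0" "poly p' b \<noteq> 0"
      using less.prems p' by auto
    moreover from this have deg: "degree p = Suc (degree p')"
      unfolding p' by (subst degree_mult_eq) auto
    ultimately obtain q' where q': "q' \<noteq> 0" "degree q' \<le> degree p'"
      "\<forall>x\<in>{a..b}. 0 \<le> poly (p' * q') x" "0 < (- 1) ^ degree q' * (poly q' a * poly q' b)"
      using less.hyps[of p'] by auto
    define q where "q = [:- c, 1:] * q'"
    have dq: "degree q = Suc (degree q')"
      unfolding q_def using q'(1) by (subst degree_mult_eq) auto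
    have "poly (p * q) x = (x - c)\<^sup>2 * poly (p' * q') x" for x
      by (simp add: p' q_def power2_eq_square algebra_simps)
    then have "\<forall>x\<in>{a..b}. 0 \<le> poly (p * q) x"
      using q'(3) by simp
    moreover have "(- 1) ^ degree q * (poly q a * poly q b) =
        ((c - a) * (b - c)) * ((- 1) ^ degree q' * (poly q' a * poly q' b))"
      unfolding dq by (simp add: q_def algebra_simps)
    then have "0 < (- 1) ^ degree q * (poly q a * poly q b)"
      using q'(4) c by simp
    moreover have "q \<noteq> 0"
      using dq by auto
    ultimately show ?thesis
      using dq deg q'(2) by (intro exI[of _ q]) auto
  next
    case False
    have pos: "0 \<le> poly p a * poly p x" if "x \<in> {a..b}" for x
    proof (rule ccontr)
      assume "\<not> 0 \<le> poly p a * poly p x"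
      moreover from this have "a < x"
        using that by (cases "a = x") auto
      ultimately obtain y where "a < y" "y < x" "poly p y = 0"
        using poly_IVT[of a x p] by auto
      then show False
        using False that by auto
    qed
    show ?thesis
      \<comment> \<open>Without zeros inside, a constant with the sign of \<open>p(a)\<close> suffices.\<close>
      using pos less.prems by (intro exI[of _ "[:poly p a:]"]) (auto simp: mult.commute zero_less_mult_iff)
  qed
qed

text \<open>The sign-matching polynomial \<open>q\<close> of \<open>\<pi>\<^sub>m\<close> must have degree \<open>m\<close>, as it would otherwise be
  orthogonal to \<open>\<pi>\<^sub>m\<close>. Since \<open>\<pi>\<^sub>m\<close> and \<open>q\<close> agree in sign at the end points, the sign of
  \<open>q(a) q(b)\<close> is that of \<open>\<pi>\<^sub>m(a) \<pi>\<^sub>m(b)\<close>.\<close>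

lemma orthogonal_polynomial_endpoint_sign:
  assumes "a < b" and w: "weight_function a b \<omega>" and o: "orthogonal_polynomials a b \<omega> \<pi>"
    and "1 \<le> m"
  shows "0 < (- 1) ^ m * (poly (\<pi> m) a * poly (\<pi> m) b)"
proof -
  have pm: "degree (\<pi> m) = m" "\<pi> m \<noteq> 0"
    using o by (auto simp: orthogonal_polynomials_degree orthogonal_polynomials_nonzero)
  have ends: "poly (\<pi> m) a \<noteq> 0" "poly (\<pi> m) b \<noteq> 0"
    using orthogonal_polynomial_endpoint_nonzero[OF w o \<open>1 \<le> m\<close>] by auto
  obtain q where q: "q \<noteq> 0" "degree q \<le> m" "\<forall>x\<in>{a..b}. 0 \<le> poly (\<pi> m * q) x"
    "0 < (- 1) ^ degree q * (poly q a * poly q b)"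
    using exists_sign_matching_poly[OF \<open>a < b\<close> ends] pm by auto
  have "degree q = m"
  proof (rule ccontr)
    assume "degree q \<noteq> m"
    then have "weighted_integral a b \<omega> (\<pi> m * q) = 0"
      using q(2) by (intro orthogonal_to_lower_degree[OF w o]) auto
    then have "\<pi> m * q = 0"
      using q(3) by (intro weighted_integral_nonneg_eq_0[OF w]) auto
    then show False
      using pm q(1) by simp
  qed
  have "poly q a \<noteq> 0" "poly q b \<noteq> 0"
    using q(4) by auto
  then have "0 < poly (\<pi> m) a * poly q a" "0 < poly (\<pi> m) b * poly q b"
    using bspec[OF q(3), of a] bspec[OF q(3), of b] \<open>a < b\<close> ends
    by (simp_all add: less_le)
  then have "0 < (poly (\<pi> m) a * poly q a) * (poly (\<pi> m) b * poly q b)"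
    by simp
  then show ?thesis
    using q(4) unfolding \<open>degree q = m\<close>
    by (cases "even m") (auto simp: zero_less_mult_iff mult_less_0_iff)
qed

lemma integral_mult_pderiv:
  fixes p :: "real poly"
  assumes "a < b"
  shows "(LINT x:{a..b}|lebesgue. poly p x * poly (pderiv p) x) = ((poly p b)\<^sup>2 - (poly p a)\<^sup>2) / 2"
proof -
  have "((\<lambda>x. (poly p x)\<^sup>2 / 2) has_vector_derivative poly p x * poly (pderiv p) x) (at x within {a..b})" for x
    unfolding has_real_derivative_iff_has_vector_derivative[symmetric]
    by (auto intro!: derivative_eq_intros)
  then have "((\<lambda>x. poly p x * poly (pderiv p) x) has_integral (poly p b)\<^sup>2 / 2 - (poly p a)\<^sup>2 / 2) {a..b}"
    using assms by (intro fundamental_theorem_of_calculus) auto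
  moreover have "(LINT x:{a..b}|lebesgue. poly p x * poly (pderiv p) x) =
      integral {a..b} (\<lambda>x. poly p x * poly (pderiv p) x)"
    by (intro set_lebesgue_integral_eq_integral absolutely_integrable_continuous_real continuous_intros)
  ultimately show ?thesis
    by (simp add: integral_unique diff_divide_distrib)
qed

text \<open>The quotient has the sign \<open>(-1)\<^sup>m\<close>: when \<open>m\<close> and \<open>N\<close> are both odd its \<open>N\<close>-th power is
  negative, when \<open>m\<close> is even it is positive itself, and when \<open>N\<close> is even the sign is lost.\<close>

lemma endpoint_quotient_power_eq_1_iff:
  assumes "a < b" and w: "weight_function a b \<omega>" and o: "orthogonal_polynomials a b \<omega> \<pi>"
    and "1 \<le> m" "1 \<le> N"
  shows "(poly (\<pi> m) b / poly (\<pi> m) a) ^ N = 1 \<longleftrightarrow>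
           even (m * N) \<and> \<bar>poly (\<pi> m) b\<bar> = \<bar>poly (\<pi> m) a\<bar>"
proof -
  define r where "r = poly (\<pi> m) b / poly (\<pi> m) a"
  have ends: "poly (\<pi> m) a \<noteq> 0" "poly (\<pi> m) b \<noteq> 0"
    using orthogonal_polynomial_endpoint_nonzero[OF w o \<open>1 \<le> m\<close>] by auto
  have "0 < (- 1) ^ m * r"
    using orthogonal_polynomial_endpoint_sign[OF assms(1-4)]
    by (cases "even m") (auto simp: r_def zero_less_mult_iff mult_less_0_iff divide_less_0_iff zero_less_divide_iff)
  moreover have "\<bar>r\<bar> = 1" if "r ^ N = 1"
    using that \<open>1 \<le> N\<close> power_eq_imp_eq_base[of "\<bar>r\<bar>" N 1] by (simp flip: power_abs)
  ultimately have "r ^ N = 1 \<longleftrightarrow> even (m * N) \<and> \<bar>r\<bar> = 1"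
    by (cases "even m"; cases "even N") (auto simp: abs_if split: if_splits)
  moreover have "\<bar>r\<bar> = 1 \<longleftrightarrow> \<bar>poly (\<pi> m) b\<bar> = \<bar>poly (\<pi> m) a\<bar>"
    using ends by (auto simp: r_def abs_divide)
  ultimately show ?thesis
    by (simp add: r_def)
qed

section \<open>Traces on the edges\<close>

lemma edge_param_unit:
  assumes "a < b"
  shows "edge_param a b v i x = edge_param 0 1 v i ((x - a) / (b - a))"
proof -
  have "(b - x) / (b - a) = 1 - (x - a) / (b - a)"
    using assms by (simp add: field_simps)
  then show ?thesis
    by (simp add: edge_param_def)
qed

lemma edge_param_endpoints:
  assumes "a < b"
  shows "edge_param a b v i a = v i" "edge_param a b v i b = v (i + 1)"
  using assms by (simp_all add: edge_param_def)

lemma edge_eq_image_edge_param: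
  assumes "a < b"
  shows "edge v i = edge_param a b v i ` {a..b}"
proof -
  have "(\<lambda>x. (x - a) / (b - a)) ` {a..b} = {0..1}"
  proof (intro equalityI subsetI)
    fix t :: real assume "t \<in> {0..1}"
    then have "0 \<le> t * (b - a)" "t * (b - a) \<le> 1 * (b - a)"
      using assms by (auto intro!: mult_nonneg_nonneg mult_right_mono)
    then have "a + t * (b - a) \<in> {a..b}"
      by simp
    moreover have "t = (a + t * (b - a) - a) / (b - a)"
      using assms by simp
    ultimately show "t \<in> (\<lambda>x. (x - a) / (b - a)) ` {a..b}"
      by blast
  qed (use assms in auto)
  moreover have "edge v i = edge_param 0 1 v i ` {0..1}"
    by (simp add: edge_def closed_segment_image_interval edge_param_def)
  ultimately show ?thesis
    using edge_param_unit[OF assms, of v i] by (metis (no_types, lifting) image_cong image_image)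
qed

lemma continuous_on_edge_param: "continuous_on S (edge_param a b v i)"
  unfolding edge_param_def divide_inverse by (intro continuous_intros)

text \<open>The parameter in \<open>[0, 1]\<close> of the orthogonal projection of a point to the line through
  an edge.\<close>

definition edge_coord :: "(nat \<Rightarrow> real^2) \<Rightarrow> nat \<Rightarrow> real^2 \<Rightarrow> real" where
  "edge_coord v i z = ((z - v i) \<bullet> (v (i + 1) - v i)) / ((v (i + 1) - v i) \<bullet> (v (i + 1) - v i))"

lemma edge_coord_edge_param:
  assumes "v i \<noteq> v (i + 1)"
  shows "edge_coord v i (edge_param 0 1 v i t) = t"
proof -
  have "edge_param 0 1 v i t - v i = t *\<^sub>R (v (i + 1) - v i)"
    by (simp add: edge_param_def algebra_simps)
  then show ?thesis
    using assms by (simp add: edge_coord_def)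
qed

lemma continuous_on_edge_coord: "continuous_on S (edge_coord v i)"
  unfolding edge_coord_def divide_inverse by (intro continuous_intros)

lemma AE_unit_interval_imp_Icc:
  fixes a b :: real
  assumes "a < b" and "AE t in lebesgue_on {0..1}. P t"
  shows "\<exists>T. negligible T \<and> (\<forall>x\<in>{a..b} - T. P ((x - a) / (b - a)))"
proof -
  have "AE t in lebesgue. t \<in> {0..1} \<longrightarrow> P t"
    using assms(2) by (subst (asm) AE_restrict_space_iff) simp_all
  then obtain S where S: "negligible S" "{t. \<not> (t \<in> {0..1} \<longrightarrow> P t)} \<subseteq> S"
    unfolding eventually_ae_filter_negligible by blast
  define T where "T = (\<lambda>t. a + t * (b - a)) ` S"
  have "negligible T"
    unfolding T_def
    by (rule negligible_differentiable_image_negligible[OF _ S(1)])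
      (auto intro!: derivative_intros differentiable_on_mult)
  moreover have "P ((x - a) / (b - a))" if "x \<in> {a..b} - T" for x
  proof (rule ccontr)
    assume "\<not> ?thesis"
    moreover have "(x - a) / (b - a) \<in> {0..1}"
      using that assms(1) by auto
    ultimately have "(x - a) / (b - a) \<in> S"
      using S(2) by blast
    moreover have "x = a + (x - a) / (b - a) * (b - a)"
      using assms(1) by simp
    ultimately show False
      using that unfolding T_def by blast
  qed
  ultimately show ?thesis by blast
qed

text \<open>Reparametrization of a polynomial in the parameter \<open>t\<close> of \<open>[0, 1]\<close> to one in the
  parameter \<open>x\<close> of \<open>[a, b]\<close>, and back.\<close>

definition poly_of_unit :: "real \<Rightarrow> real \<Rightarrow> real poly \<Rightarrow> real poly" where
  "poly_of_unit a b p = pcompose p [:- a / (b - a), 1 / (b - a):]"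

definition poly_to_unit :: "real \<Rightarrow> real \<Rightarrow> real poly \<Rightarrow> real poly" where
  "poly_to_unit a b p = pcompose p [:a, b - a:]"

lemma poly_of_unit:
  "poly (poly_of_unit a b p) x = poly p ((x - a) / (b - a))"
  "a < b \<Longrightarrow> degree (poly_of_unit a b p) = degree p"
  by (simp_all add: poly_of_unit_def poly_pcompose degree_pcompose diff_divide_distrib)

lemma poly_to_unit:
  "poly (poly_to_unit a b p) t = poly p (a + t * (b - a))"
  "a < b \<Longrightarrow> degree (poly_to_unit a b p) = degree p"
  by (simp_all add: poly_to_unit_def poly_pcompose degree_pcompose)

lemma edge_trace_piecewise_poly:
  assumes "a < b" "f \<in> piecewise_poly_space N v m" "i \<in> {1..N}"
  shows "\<exists>p. degree p \<le> m \<and>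
           (\<exists>T. negligible T \<and> (\<forall>x\<in>{a..b} - T. edge_trace a b v i f x = poly p x))"
proof -
  obtain p where p: "degree p \<le> m"
    "AE t in lebesgue_on {0..1}. f (edge_param 0 1 v i t) = poly p t"
    using assms(2,3) unfolding piecewise_poly_space_def by blast
  show ?thesis
    using AE_unit_interval_imp_Icc[OF assms(1) p(2)] p(1) assms(1)
    by (intro exI[of _ "poly_of_unit a b p"])
      (simp add: poly_of_unit edge_trace_def edge_param_unit[OF assms(1)])
qed

lemma edge_trace_boundary_ae_eq:
  assumes "a < b" "boundary_ae_eq N v f g" "i \<in> {1..N}"
  shows "\<exists>T. negligible T \<and> (\<forall>x\<in>{a..b} - T. edge_trace a b v i f x = edge_trace a b v i g x)"
  using AE_unit_interval_imp_Icc[OF assms(1)] assms(2,3)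
  unfolding boundary_ae_eq_def edge_trace_def edge_param_unit[OF assms(1)] by blast

text \<open>Equality almost everywhere is equality for continuous functions; hence the traces of elements
  of the continuous space are polynomials everywhere, including at the vertices.\<close>

lemma continuous_eq_if_eq_off_negligible:
  fixes f g :: "real \<Rightarrow> real"
  assumes "a < b" "continuous_on {a..b} f" "continuous_on {a..b} g"
    and "negligible T" "\<And>x. x \<in> {a..b} - T \<Longrightarrow> f x = g x" and "x \<in> {a..b}"
  shows "f x = g x"
proof -
  have "integral {a..b} (\<lambda>x. (f x - g x)\<^sup>2) = integral {a..b} (\<lambda>x. 0)"
    using assms(5) by (intro integral_spike[OF assms(4)]) auto
  then have "\<forall>x\<in>{a..b}. (f x - g x)\<^sup>2 = 0"
    using assms by (subst integral_eq_0_iff[symmetric]) (auto intro!: continuous_intros)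
  then show ?thesis
    using assms(6) by simp
qed

lemma edge_subset_frontier:
  assumes "polygon K N v" "i \<in> {1..N}"
  shows "edge v i \<subseteq> frontier K"
  using assms by (auto simp: polygon_def)

lemma edge_trace_continuous_piecewise_poly:
  assumes "a < b" "polygon K N v" "f \<in> continuous_piecewise_poly_space K N v m" "i \<in> {1..N}"
  shows "\<exists>p. degree p \<le> m \<and> (\<forall>x\<in>{a..b}. edge_trace a b v i f x = poly p x)"
proof -
  have f: "f \<in> piecewise_poly_space N v m" "continuous_on (frontier K) f"
    using assms(3) by (auto simp: continuous_piecewise_poly_space_def)
  obtain p T where p: "degree p \<le> m" "negligible T"
    "\<And>x. x \<in> {a..b} - T \<Longrightarrow> edge_trace a b v i f x = poly p x"
    using edge_trace_piecewise_poly[OF assms(1) f(1) assms(4)] by blast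
  have "continuous_on (edge_param a b v i ` {a..b}) f"
    using f(2) edge_subset_frontier[OF assms(2,4)]
    unfolding edge_eq_image_edge_param[OF assms(1)] by (rule continuous_on_subset)
  then have "continuous_on {a..b} (edge_trace a b v i f)"
    unfolding edge_trace_def by (rule continuous_on_compose2[OF _ continuous_on_edge_param]) auto
  moreover have "continuous_on {a..b} (poly p)"
    by (intro continuous_intros)
  ultimately have "edge_trace a b v i f x = poly p x" if "x \<in> {a..b}" for x
    using continuous_eq_if_eq_off_negligible[of a b "edge_trace a b v i f" "poly p" T x] assms(1) p(2,3) that by blast
  then show ?thesis
    using p(1) by blast
qed

text \<open>Changing the traces on negligible sets does not change a boundary moment, so it is a sum of
  weighted integrals of polynomials.\<close>

lemma boundary_moment_eq_sum:
  assumes w: "weight_function a b \<omega>"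
    and f: "\<And>i x. i \<in> {1..N} \<Longrightarrow> x \<in> {a..b} \<Longrightarrow> edge_trace a b v i f x = poly (p i) x"
    and g: "\<And>i. i \<in> {1..N} \<Longrightarrow>
      \<exists>T. negligible T \<and> (\<forall>x\<in>{a..b} - T. edge_trace a b v i g x = poly (q i) x)"
  shows "boundary_moment a b \<omega> N v g f = (\<Sum>i = 1..N. weighted_integral a b \<omega> (p i * q i))"
  unfolding boundary_moment_def
proof (rule sum.cong)
  fix i assume i: "i \<in> {1..N}"
  let ?h = "\<lambda>x. edge_trace a b v i f x * edge_trace a b v i g x * \<omega> x"
  let ?k = "\<lambda>x. poly (p i * q i) x * \<omega> x"
  obtain T where T: "negligible T" "\<And>x. x \<in> {a..b} - T \<Longrightarrow> edge_trace a b v i g x = poly (q i) x"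
    using g[OF i] by blast
  have eq: "?h x = ?k x" if "x \<in> {a..b} - T" for x
    using that T(2) f[OF i] by simp
  have k: "set_integrable lebesgue {a..b} ?k"
    by (rule set_integrable_poly_weight[OF w])
  then have h: "set_integrable lebesgue {a..b} ?h"
    by (rule absolutely_integrable_spike[OF _ T(1) eq])
  have "integral {a..b} ?k = integral {a..b} ?h"
    by (rule integral_spike[OF T(1) eq])
  then show "(LINT x:{a..b}|lebesgue. ?h x) = weighted_integral a b \<omega> (p i * q i)"
    by (simp only: weighted_integral_def set_lebesgue_integral_eq_integral(2)[OF h]
        set_lebesgue_integral_eq_integral(2)[OF k])
qed simp

lemma polygon_consecutive_vertices_distinct:
  assumes "polygon K N v" "i \<in> {1..N}"
  shows "v i \<noteq> v (i + 1)"
proof (cases "i = N")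
  case True
  then have "v N \<noteq> v 1"
    using assms inj_onD[of v "{1..N}" N 1] by (auto simp: polygon_def)
  then show ?thesis
    using True assms by (simp add: polygon_def)
next
  case False
  then show ?thesis
    using assms inj_onD[of v "{1..N}" i "i + 1"] by (auto simp: polygon_def)
qed

text \<open>A polynomial on one edge, continued by zero to the other edges, belongs to the piecewise
  polynomials: different edges meet in vertices only.\<close>

lemma single_edge_poly_in_space:
  assumes "polygon K N v" "k \<in> {1..N}" "degree q \<le> m"
  defines "g \<equiv> \<lambda>z. if z \<in> edge v k then poly q (edge_coord v k z) else 0"
  shows "i \<in> {1..N} \<Longrightarrow>
      AE t in lebesgue_on {0..1}. g (edge_param 0 1 v i t) = poly (if i = k then q else 0) t"
    and "g \<in> piecewise_poly_space N v m"
proof -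
  show AE: "AE t in lebesgue_on {0..1}. g (edge_param 0 1 v i t) = poly (if i = k then q else 0) t"
    if i: "i \<in> {1..N}" for i
  proof (subst AE_restrict_space_iff)
    note ne = polygon_consecutive_vertices_distinct[OF assms(1) i]
    have "g (edge_param 0 1 v i t) = poly (if i = k then q else 0) t" if t: "t \<in> {0..1} - {0, 1}" for t
    proof -
      have z: "edge_param 0 1 v i t \<in> edge v i"
        using t edge_eq_image_edge_param[of 0 1 v i] by auto
      show ?thesis
      proof (cases "i = k")
        case True
        then show ?thesis
          using z ne by (simp add: g_def edge_coord_edge_param)
      next
        case False
        have "edge_coord v i (v i) = 0" "edge_coord v i (v (i + 1)) = 1"
          using edge_coord_edge_param[of v i, OF ne] edge_param_endpoints[of 0 1 v i] by (metis zero_less_one)+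
        then have "edge_param 0 1 v i t \<notin> {v i, v (i + 1)}"
          using t edge_coord_edge_param[of v i t, OF ne] by auto
        then have "edge_param 0 1 v i t \<notin> edge v k"
          using z False assms(1,2) i unfolding polygon_def by blast
        then show ?thesis
          using False by (simp add: g_def)
      qed
    qed
    moreover have "negligible {0, 1 :: real}"
      by (intro negligible_finite) auto
    ultimately show "AE t in lebesgue. t \<in> {0..1} \<longrightarrow>
        g (edge_param 0 1 v i t) = poly (if i = k then q else 0) t"
      unfolding eventually_ae_filter_negligible by (intro exI[of _ "{0, 1}"]) blast
  qed simp
  show "g \<in> piecewise_poly_space N v m"
    unfolding piecewise_poly_space_def
  proof (intro CollectI ballI)
    fix i assume "i \<in> {1..N}"
    from AE[OF this] show "\<exists>p. degree p \<le> m \<and> (AE t in lebesgue_on {0..1}. g (edge_param 0 1 v i t) = poly p t)"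
      using assms(3) by (intro exI[of _ "if i = k then q else 0"]) auto
  qed
qed

section \<open>Vanishing moments\<close>

text \<open>The moment against an arbitrary element of the space spanned by the basis is the
  corresponding combination of the moments against the basis, hence zero. Taking a polynomial
  supported on the \<open>k\<close>-th edge isolates the trace on that edge.\<close>

lemma moments_zero_imp_orthogonal:
  assumes "a < b" and w: "weight_function a b \<omega>" and K: "polygon K N v"
    and basis: "piecewise_poly_basis N v n J \<beta>"
    and f: "\<And>i x. i \<in> {1..N} \<Longrightarrow> x \<in> {a..b} \<Longrightarrow> edge_trace a b v i f x = poly (p i) x"
    and zero: "\<And>j. j \<in> J \<Longrightarrow> boundary_moment a b \<omega> N v (\<beta> j) f = 0"
    and k: "k \<in> {1..N}" and q: "degree q \<le> n"
  shows "weighted_integral a b \<omega> (p k * q) = 0"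
proof -
  define Q where "Q i = (if i = k then q else 0)" for i
  define g where "g z = (if z \<in> edge v k then poly (poly_to_unit a b q) (edge_coord v k z) else 0)" for z
  have dq: "degree (poly_to_unit a b q) \<le> n"
    using q \<open>a < b\<close> by (simp add: poly_to_unit)
  note g = single_edge_poly_in_space[OF K k dq, folded g_def]
  have gQ: "\<exists>T. negligible T \<and> (\<forall>x\<in>{a..b} - T. edge_trace a b v i g x = poly (Q i) x)"
    if "i \<in> {1..N}" for i
  proof -
    have eq: "poly (if i = k then poly_to_unit a b q else 0) ((x - a) / (b - a)) = poly (Q i) x" for x
      using \<open>a < b\<close> by (simp add: Q_def poly_to_unit)
    show ?thesis
      using AE_unit_interval_imp_Icc[OF \<open>a < b\<close> g(1)[OF that]]
      unfolding edge_trace_def edge_param_unit[OF \<open>a < b\<close>] eq .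
  qed
  obtain c :: "nat \<Rightarrow> real" where c: "boundary_ae_eq N v g (\<lambda>z. \<Sum>j\<in>J. c j * \<beta> j z)"
    using basis g(2) unfolding piecewise_poly_basis_def by blast
  have "\<forall>j\<in>J. \<forall>i\<in>{1..N}. \<exists>p. \<exists>T. negligible T \<and>
      (\<forall>x\<in>{a..b} - T. edge_trace a b v i (\<beta> j) x = poly p x)"
  proof (intro ballI)
    fix j i assume "j \<in> J" and i: "i \<in> {1..N}"
    then have "\<beta> j \<in> piecewise_poly_space N v n"
      using basis by (simp add: piecewise_poly_basis_def)
    from edge_trace_piecewise_poly[OF \<open>a < b\<close> this i]
    show "\<exists>p. \<exists>T. negligible T \<and> (\<forall>x\<in>{a..b} - T. edge_trace a b v i (\<beta> j) x = poly p x)"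
      by blast
  qed
  then obtain B where "\<forall>j\<in>J. \<forall>i\<in>{1..N}. \<exists>T. negligible T \<and>
      (\<forall>x\<in>{a..b} - T. edge_trace a b v i (\<beta> j) x = poly (B j i) x)"
    by metis
  then have B: "\<exists>T. negligible T \<and> (\<forall>x\<in>{a..b} - T. edge_trace a b v i (\<beta> j) x = poly (B j i) x)"
    if "j \<in> J" "i \<in> {1..N}" for j i
    using that by blast
  have gB: "\<exists>T. negligible T \<and> (\<forall>x\<in>{a..b} - T. edge_trace a b v i g x = poly (\<Sum>j\<in>J. smult (c j) (B j i)) x)"
    if i: "i \<in> {1..N}" for i
  proof (cases "finite J")
    case True
    obtain T0 where T0: "negligible T0" "\<And>x. x \<in> {a..b} - T0 \<Longrightarrow>
        edge_trace a b v i g x = edge_trace a b v i (\<lambda>z. \<Sum>j\<in>J. c j * \<beta> j z) x"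
      using edge_trace_boundary_ae_eq[OF \<open>a < b\<close> c i] by blast
    obtain T where T: "\<And>j. j \<in> J \<Longrightarrow> negligible (T j)"
      "\<And>j x. j \<in> J \<Longrightarrow> x \<in> {a..b} - T j \<Longrightarrow> edge_trace a b v i (\<beta> j) x = poly (B j i) x"
      using B[OF _ i] by metis
    have "negligible (T0 \<union> \<Union> (T ` J))"
      using T0(1) T(1) True by (intro negligible_Un negligible_Union) auto
    moreover have "edge_trace a b v i g x = poly (\<Sum>j\<in>J. smult (c j) (B j i)) x"
      if "x \<in> {a..b} - (T0 \<union> \<Union> (T ` J))" for x
    proof -
      have "edge_trace a b v i g x = (\<Sum>j\<in>J. c j * edge_trace a b v i (\<beta> j) x)"
        using T0(2)[of x] that by (simp add: edge_trace_def)
      also have "\<dots> = (\<Sum>j\<in>J. c j * poly (B j i) x)"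
        using T(2) that by (intro sum.cong) auto
      finally show ?thesis
        by (simp add: poly_sum)
    qed
    ultimately show ?thesis by blast
  next
    case False
    then show ?thesis
      using edge_trace_boundary_ae_eq[OF \<open>a < b\<close> c i] by (simp add: edge_trace_def)
  qed
  have "weighted_integral a b \<omega> (p k * q) = (\<Sum>i = 1..N. weighted_integral a b \<omega> (p i * Q i))"
    using k by (simp add: Q_def if_distrib weighted_integral_0 sum.delta cong: if_cong)
  also have "\<dots> = boundary_moment a b \<omega> N v g f"
    by (rule boundary_moment_eq_sum[OF w f gQ, symmetric])
  also have "\<dots> = (\<Sum>i = 1..N. weighted_integral a b \<omega> (p i * (\<Sum>j\<in>J. smult (c j) (B j i))))"
    by (rule boundary_moment_eq_sum[OF w f gB])
  also have "\<dots> = (\<Sum>i = 1..N. \<Sum>j\<in>J. c j * weighted_integral a b \<omega> (p i * B j i))"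
    by (simp add: sum_distrib_left weighted_integral_sum[OF w] weighted_integral_smult)
  also have "\<dots> = (\<Sum>j\<in>J. c j * (\<Sum>i = 1..N. weighted_integral a b \<omega> (p i * B j i)))"
    by (subst sum.swap) (simp add: sum_distrib_left)
  also have "\<dots> = (\<Sum>j\<in>J. c j * boundary_moment a b \<omega> N v (\<beta> j) f)"
    using boundary_moment_eq_sum[OF w f B] by (intro sum.cong) auto
  also have "\<dots> = 0"
    using zero by simp
  finally show ?thesis .
qed

lemma finite_element_if_power_ne_1:
  assumes "a < b" and w: "weight_function a b \<omega>" and o: "orthogonal_polynomials a b \<omega> \<pi>"
    and K: "polygon K N v" and "1 \<le> m" and basis: "piecewise_poly_basis N v (m - 1) {1..m * N} \<beta>"
    and ne: "(poly (\<pi> m) b / poly (\<pi> m) a) ^ N \<noteq> 1"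
  shows "defines_finite_element (element_triple a b \<omega> K N v m \<beta>)"
  unfolding element_triple_def defines_finite_element.simps
proof (intro ballI impI)
  fix f z
  assume f: "f \<in> continuous_piecewise_poly_space K N v m" and z: "z \<in> frontier K"
    and "\<forall>l\<in>(\<lambda>j. boundary_moment a b \<omega> N v (\<beta> j)) ` {1..m * N}. l f = 0"
  then have zero: "boundary_moment a b \<omega> N v (\<beta> j) f = 0" if "j \<in> {1..m * N}" for j
    using that by blast
  obtain p where p: "\<And>i. i \<in> {1..N} \<Longrightarrow> degree (p i) \<le> m"
    "\<And>i x. i \<in> {1..N} \<Longrightarrow> x \<in> {a..b} \<Longrightarrow> edge_trace a b v i f x = poly (p i) x"
    using edge_trace_continuous_piecewise_poly[OF \<open>a < b\<close> K f] by metis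
  have "\<exists>c. p i = smult c (\<pi> m)" if i: "i \<in> {1..N}" for i
    using orthogonal_to_lower_degree_imp_multiple[OF w o \<open>1 \<le> m\<close> p(1)[OF i]
        moments_zero_imp_orthogonal[OF \<open>a < b\<close> w K basis p(2) zero i]] .
  then obtain c where c: "\<And>i. i \<in> {1..N} \<Longrightarrow> p i = smult (c i) (\<pi> m)"
    by metis
  have tr: "f (edge_param a b v i x) = c i * poly (\<pi> m) x" if "i \<in> {1..N}" "x \<in> {a..b}" for i x
    using p(2)[OF that] c[OF that(1)] by (simp add: edge_trace_def)
  have left: "f (v i) = c i * poly (\<pi> m) a" and right: "f (v (i + 1)) = c i * poly (\<pi> m) b"
    if "i \<in> {1..N}" for i
    using tr[OF that, of a] tr[OF that, of b] \<open>a < b\<close> by (simp_all add: edge_param_endpoints)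
  define r where "r = poly (\<pi> m) b / poly (\<pi> m) a"
  have a0: "poly (\<pi> m) a \<noteq> 0"
    using orthogonal_polynomial_endpoint_nonzero[OF w o \<open>1 \<le> m\<close>] by auto
  have N: "3 \<le> N" "v (N + 1) = v 1"
    using K by (auto simp: polygon_def)
  \<comment> \<open>Continuity at the vertices determines all coefficients from the first one.\<close>
  have pow: "i + 1 \<le> N \<Longrightarrow> c (i + 1) = r ^ i * c 1" for i
  proof (induction i)
    case (Suc i)
    then have "c (i + 1) * poly (\<pi> m) b = c (i + 2) * poly (\<pi> m) a"
      using right[of "i + 1"] left[of "i + 2"] by simp
    then have "c (i + 2) = r * c (i + 1)"
      using a0 by (simp add: r_def field_simps)
    then show ?case
      using Suc by simp
  qed simp
  \<comment> \<open>The last edge ends in the first vertex.\<close>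
  have "c N * poly (\<pi> m) b = c 1 * poly (\<pi> m) a"
    using right[of N] left[of 1] N by simp
  then have "c 1 = r * c N"
    using a0 by (simp add: r_def field_simps)
  also have "\<dots> = r ^ N * c 1"
    using pow[of "N - 1"] N by (simp flip: power_Suc)
  finally have "c 1 = 0"
    using ne by (auto simp: r_def)
  obtain i where i: "i \<in> {1..N}" "z \<in> edge v i"
    using z K unfolding polygon_def by blast
  then obtain x where x: "x \<in> {a..b}" "z = edge_param a b v i x"
    using edge_eq_image_edge_param[OF \<open>a < b\<close>] by auto
  have "c i = 0"
    using pow[of "i - 1"] i \<open>c 1 = 0\<close> by auto
  then show "f z = 0"
    using tr[OF i(1) x(1)] x(2) by simp
qed

section \<open>A continuous function with vanishing moments\<close>

text \<open>Continuous functions on the edges which agree at common end points of consecutive edges define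
  a continuous function on the boundary, since different edges meet in vertices only and the edges
  are finitely many closed sets.\<close>

lemma polygon_edge_functions_glue:
  fixes g :: "nat \<Rightarrow> real^2 \<Rightarrow> real"
  assumes K: "polygon K N v" and cont: "\<And>i. i \<in> {1..N} \<Longrightarrow> continuous_on (edge v i) (g i)"
    and vert: "\<And>i. i \<in> {1..<N} \<Longrightarrow> g i (v (i + 1)) = g (i + 1) (v (i + 1))"
    and closing: "g N (v 1) = g 1 (v 1)"
  shows "\<exists>f. continuous_on (frontier K) f \<and> (\<forall>i\<in>{1..N}. \<forall>z\<in>edge v i. f z = g i z)"
proof -
  have v: "3 \<le> N" "v (N + 1) = v 1" "inj_on v {1..N}"
    and disj: "\<And>i j. i \<in> {1..N} \<Longrightarrow> j \<in> {1..N} \<Longrightarrow> i \<noteq> j \<Longrightarrow>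
        edge v i \<inter> edge v j = {v i, v (i + 1)} \<inter> {v j, v (j + 1)}"
    and front: "frontier K = (\<Union>i\<in>{1..N}. edge v i)"
    using K by (auto simp: polygon_def)
  have at_vertex: "g i (v k) = g k (v k)"
    if ik: "i \<in> {1..N}" "k \<in> {1..N}" "v k \<in> {v i, v (i + 1)}" for i k
  proof -
    consider "v k = v i" | "v k = v (i + 1)" "i < N" | "v k = v 1" "i = N"
      using ik v(2) by (cases "i = N") auto
    then show ?thesis
    proof cases
      case 1
      then have "k = i" using ik v(3) by (auto dest: inj_onD)
      then show ?thesis by simp
    next
      case 2
      then have "k = i + 1" using ik v(3) by (auto dest: inj_onD)
      then show ?thesis using vert[of i] 2 ik by simp
    next
      case 3
      then have "k = 1" using ik v by (auto dest: inj_onD)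
      then show ?thesis using closing 3 by simp
    qed
  qed
  have consistent: "g i z = g j z"
    if "i \<in> {1..N}" "j \<in> {1..N}" "z \<in> edge v i" "z \<in> edge v j" for i j z
  proof (cases "i = j")
    case False
    have z: "z \<in> {v i, v (i + 1)}" "z \<in> {v j, v (j + 1)}"
      using disj[OF that(1,2) False] that(3,4) by blast+
    have "\<exists>k\<in>{1..N}. z = v k"
    proof (cases "z = v i")
      case False
      then show ?thesis
        using z(1) v(1,2) that(1) by (cases "i = N") (auto intro: bexI[of _ 1] bexI[of _ "i + 1"])
    qed (use that in blast)
    then show ?thesis
      using at_vertex that(1,2) z by metis
  qed simp
  define f where "f z = g (SOME i. i \<in> {1..N} \<and> z \<in> edge v i) z" for z
  have f: "f z = g i z" if "i \<in> {1..N}" "z \<in> edge v i" for i z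
    using someI[of "\<lambda>i. i \<in> {1..N} \<and> z \<in> edge v i" i] that consistent unfolding f_def by blast
  have "continuous_on (\<Union> (edge v ` {1..N})) f"
  proof (rule continuous_on_closed_Union)
    show "continuous_on (edge v i) f" if "i \<in> {1..N}" for i
      using cont[OF that] f[OF that] by (simp cong: continuous_on_cong)
  qed (auto simp: edge_def)
  then show ?thesis
    using f front by auto
qed

lemma not_finite_element_if_power_eq_1:
  assumes "a < b" and w: "weight_function a b \<omega>" and o: "orthogonal_polynomials a b \<omega> \<pi>"
    and K: "polygon K N v" and "1 \<le> m" and basis: "piecewise_poly_basis N v (m - 1) {1..m * N} \<beta>"
    and one: "(poly (\<pi> m) b / poly (\<pi> m) a) ^ N = 1"
  shows "\<not> defines_finite_element (element_triple a b \<omega> K N v m \<beta>)"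
proof -
  define r where "r = poly (\<pi> m) b / poly (\<pi> m) a"
  have a0: "poly (\<pi> m) a \<noteq> 0"
    using orthogonal_polynomial_endpoint_nonzero[OF w o \<open>1 \<le> m\<close>] by auto
  have N: "3 \<le> N" "v (N + 1) = v 1"
    using K by (auto simp: polygon_def)
  have r: "r * poly (\<pi> m) a = poly (\<pi> m) b" "r ^ N = 1"
    using one a0 by (auto simp: r_def)
  \<comment> \<open>The factors \<open>r ^ i\<close> make the traces match at the vertices; \<open>r ^ N = 1\<close> closes the loop.\<close>
  define g where "g i z = r ^ i * poly (\<pi> m) (a + edge_coord v i z * (b - a))" for i z
  have ne: "v i \<noteq> v (i + 1)" if "i \<in> {1..N}" for i
    using polygon_consecutive_vertices_distinct[OF K that] .
  have coord: "edge_coord v i (v i) = 0" "edge_coord v i (v (i + 1)) = 1" if "i \<in> {1..N}" for i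
    using edge_coord_edge_param[of v i, OF ne[OF that]] edge_param_endpoints[of 0 1 v i]
    by (metis zero_less_one)+
  have g_left: "g i (v i) = r ^ i * poly (\<pi> m) a"
    and g_right: "g i (v (i + 1)) = r ^ (i + 1) * poly (\<pi> m) a" if "i \<in> {1..N}" for i
    using coord[OF that] r(1) by (simp_all add: g_def)
  have "\<exists>f. continuous_on (frontier K) f \<and> (\<forall>i\<in>{1..N}. \<forall>z\<in>edge v i. f z = g i z)"
  proof (rule polygon_edge_functions_glue[OF K])
    show "continuous_on (edge v i) (g i)" for i
      unfolding g_def by (intro continuous_intros continuous_on_edge_coord)
    show "g i (v (i + 1)) = g (i + 1) (v (i + 1))" if "i \<in> {1..<N}" for i
      using g_right[of i] g_left[of "i + 1"] that by simp
    show "g N (v 1) = g 1 (v 1)"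
      using g_right[of N] g_left[of 1] N r(2) by simp
  qed
  then obtain f where f: "continuous_on (frontier K) f"
    "\<And>i z. i \<in> {1..N} \<Longrightarrow> z \<in> edge v i \<Longrightarrow> f z = g i z"
    by blast
  have unit: "f (edge_param 0 1 v i t) = poly (poly_to_unit a b (smult (r ^ i) (\<pi> m))) t"
    if "i \<in> {1..N}" "t \<in> {0..1}" for i t
  proof -
    have "edge_param 0 1 v i t \<in> edge v i"
      using that(2) edge_eq_image_edge_param[of 0 1 v i] by auto
    then show ?thesis
      using f(2)[OF that(1)] ne[OF that(1)] by (simp add: g_def edge_coord_edge_param poly_to_unit)
  qed
  have "f \<in> piecewise_poly_space N v m"
    unfolding piecewise_poly_space_def
  proof (intro CollectI ballI exI conjI)
    fix i assume i: "i \<in> {1..N}"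
    show "degree (poly_to_unit a b (smult (r ^ i) (\<pi> m))) \<le> m"
      using \<open>a < b\<close> orthogonal_polynomials_degree[OF o, of m]
      by (simp add: poly_to_unit)
    show "AE t in lebesgue_on {0..1}.
        f (edge_param 0 1 v i t) = poly (poly_to_unit a b (smult (r ^ i) (\<pi> m))) t"
      using unit[OF i] by (intro AE_I2) simp
  qed
  then have mem: "f \<in> continuous_piecewise_poly_space K N v m"
    using f(1) by (simp add: continuous_piecewise_poly_space_def)
  have tr: "edge_trace a b v i f x = poly (smult (r ^ i) (\<pi> m)) x" if "i \<in> {1..N}" "x \<in> {a..b}" for i x
    using unit[OF that(1), of "(x - a) / (b - a)"] that(2) \<open>a < b\<close>
    by (simp add: edge_trace_def edge_param_unit[OF \<open>a < b\<close>] poly_to_unit)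
  have "boundary_moment a b \<omega> N v (\<beta> j) f = 0" if "j \<in> {1..m * N}" for j
  proof -
    have "\<beta> j \<in> piecewise_poly_space N v (m - 1)"
      using basis that by (simp add: piecewise_poly_basis_def)
    then obtain q where q: "\<And>i. i \<in> {1..N} \<Longrightarrow> degree (q i) \<le> m - 1"
      "\<And>i. i \<in> {1..N} \<Longrightarrow> \<exists>T. negligible T \<and> (\<forall>x\<in>{a..b} - T. edge_trace a b v i (\<beta> j) x = poly (q i) x)"
      using edge_trace_piecewise_poly[OF \<open>a < b\<close>, of "\<beta> j" N v "m - 1"] by metis
    have "weighted_integral a b \<omega> (\<pi> m * q i) = 0" if "i \<in> {1..N}" for i
      using q(1)[OF that] \<open>1 \<le> m\<close> by (intro orthogonal_to_lower_degree[OF w o]) auto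
    then have "(\<Sum>i = 1..N. weighted_integral a b \<omega> (smult (r ^ i) (\<pi> m) * q i)) = 0"
      by (intro sum.neutral) (simp add: weighted_integral_smult)
    then show ?thesis
      using boundary_moment_eq_sum[of a b \<omega> N v f "\<lambda>i. smult (r ^ i) (\<pi> m)", OF w tr q(2)] by simp
  qed
  moreover have "v 1 \<in> frontier K"
    using edge_subset_frontier[OF K, of 1] N by (auto simp: edge_def)
  moreover have "f (v 1) \<noteq> 0"
  proof -
    have "f (v 1) = g 1 (v 1)"
      using N by (intro f(2)) (auto simp: edge_def)
    moreover have "r \<noteq> 0"
      using r(2) N by (auto simp: power_0_left)
    ultimately show ?thesis
      using g_left[of 1] N a0 by simp
  qed
  ultimately show ?thesis
    using mem unfolding element_triple_def defines_finite_element.simps by blast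
qed

section \<open>The characterization of unisolvence\<close>

theorem theorem2:
  fixes a b :: real
    and \<omega> :: "real \<Rightarrow> real"
    and \<pi> :: "nat \<Rightarrow> real poly"
    and K :: "(real^2) set"
    and v :: "nat \<Rightarrow> real^2"
    and N m :: nat
    and \<beta> :: "nat \<Rightarrow> real^2 \<Rightarrow> real"
  assumes "a < b"
    and "weight_function a b \<omega>"
    and "orthogonal_polynomials a b \<omega> \<pi>"
    and "polygon K N v"
    and "1 \<le> m"
    and "piecewise_poly_basis N v (m - 1) {1..m * N} \<beta>"
  shows "(odd (m * N) \<longrightarrow> defines_finite_element (element_triple a b \<omega> K N v m \<beta>)) \<and>
         (even (m * N) \<longrightarrow>
            (defines_finite_element (element_triple a b \<omega> K N v m \<beta>) \<longleftrightarrow>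
               \<bar>poly (\<pi> m) b\<bar> \<noteq> \<bar>poly (\<pi> m) a\<bar>) \<and>
            (\<bar>poly (\<pi> m) b\<bar> \<noteq> \<bar>poly (\<pi> m) a\<bar> \<longleftrightarrow>
               (LINT x:{a..b}|lebesgue. poly (\<pi> m) x * poly (pderiv (\<pi> m)) x) \<noteq> 0))"
proof -
  have "1 \<le> N"
    using assms(4) by (simp add: polygon_def)
  have "defines_finite_element (element_triple a b \<omega> K N v m \<beta>) \<longleftrightarrow>
      (poly (\<pi> m) b / poly (\<pi> m) a) ^ N \<noteq> 1"
    using finite_element_if_power_ne_1[OF assms] not_finite_element_if_power_eq_1[OF assms] by blast
  also have "\<dots> \<longleftrightarrow> odd (m * N) \<or> \<bar>poly (\<pi> m) b\<bar> \<noteq> \<bar>poly (\<pi> m) a\<bar>"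
    using endpoint_quotient_power_eq_1_iff[OF assms(1-3,5) \<open>1 \<le> N\<close>] by blast
  finally have "defines_finite_element (element_triple a b \<omega> K N v m \<beta>) \<longleftrightarrow>
      odd (m * N) \<or> \<bar>poly (\<pi> m) b\<bar> \<noteq> \<bar>poly (\<pi> m) a\<bar>" .
  moreover have "(LINT x:{a..b}|lebesgue. poly (\<pi> m) x * poly (pderiv (\<pi> m)) x) \<noteq> 0 \<longleftrightarrow>
      \<bar>poly (\<pi> m) b\<bar> \<noteq> \<bar>poly (\<pi> m) a\<bar>"
    unfolding integral_mult_pderiv[OF assms(1)] by (simp add: abs_eq_iff power2_eq_iff)
  ultimately show ?thesis
    by blast
qed

end
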